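(* Let $y$ be a positive integer with binary expansion $y=2^{k_1}+2^{k_2}+\cdots+2^{k_r}$, $k_1>k_2>\cdots>k_r$, let $t(y)=(-1)^{k_1}+(-1)^{k_2}+\cdots+(-1)^{k_r}$, and let $m$ be an integer with $1\leq m<k_r$. Then: a) if $t(y)\equiv 0\pmod 6$, then $S_{3,0}([y,y+2^m))=S_{3,0}(2^m)$; b) if $t(y)\equiv 1\pmod 6$, then for every integer $n>\frac m2$, $S_{3,0}([y,y+2^m))=S_{3,0}([2^{2n},2^{2n}+2^m))$; c) if $t(y)\equiv 2\pmod 6$, then for all integers $k>\frac{m+2}{2}$ and $n>\frac{m+1}{2}$, $$S_{3,0}([y,y+2^m))=S_{3,0}([2^{2k}+2^{2k-2},\,2^{2k}+2^{2k-2}+2^m))=-S_{3,0}([2^{2n-1},2^{2n-1}+2^m));$$ d) if $t(y)\equiv 3\pmod 6$, then $S_{3,0}([y,y+2^m))=-S_{3,0}(2^m)$; e) if $t(y)\equiv 4\pmod 6$, then for all integers $k>\frac{m+6}{2}$ and $n>\frac m2$, with $u=2^{2k}+2^{2k-2}+2^{2k-4}+2^{2k-6}$, $$S_{3,0}([y,y+2^m))=S_{3,0}([u,u+2^m))=-S_{3,0}([2^{2n},2^{2n}+2^m));$$ f) if $t(y)\equiv 5\pmod 6$, then for all integers $k>\frac{m+2}{2}$ and $n>\frac{m+1}{2}$, $$S_{3,0}([y,y+2^m))=-S_{3,0}([2^{2k}+2^{2k-2},\,2^{2k}+2^{2k-2}+2^m))=S_{3,0}([2^{2n-1},2^{2n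-1}+2^m)).$$
   Context: For a nonnegative integer $n$, $s(n)$ denotes the sum of the binary digits of $n$. For a nonnegative integer $x$, $$S_{3,0}(x)=\sum_{0\leq n<x,\ n\equiv 0 \pmod 3}(-1)^{s(n)}.$$ For nonnegative integers $y,z$, $S_{3,0}([y,y+z))=S_{3,0}(y+z)-S_{3,0}(y)$. *)

theory Defs
  imports Complex_Main "HOL-Number_Theory.Cong"
begin

fun binary_digit_sum :: "nat \<Rightarrow> nat" where
  "binary_digit_sum n = (if n = 0 then 0 else n mod 2 + binary_digit_sum (n div 2))"

declare binary_digit_sum.simps [simp del]

definition S30 :: "nat \<Rightarrow> int" where
  "S30 x = (\<Sum>n | n < x \<and> [n = 0] (mod 3). (-1) ^ binary_digit_sum n)"

text \<open>\<open>S30_ivl a b\<close> is the value of \<open>S\<^sub>3\<^sub>,\<^sub>0\<close> on the half-open interval \<open>[a, b)\<close>, for \<open>a \<le> b\<close>.\<close>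

definition S30_ivl :: "nat \<Rightarrow> nat \<Rightarrow> int" where
  "S30_ivl a b = S30 b - S30 a"

end

(* Adding a j < 2^m to a multiple y of 2^m causes no carries, so the sum over [y, y + 2^m) equals
   (-1)^s(y) times a sum over j < 2^m that depends only on y mod 3. If y is a sum of distinct
   powers 2^i, i in A, and t is the sum of the (-1)^i, then y = t (mod 3) because 2 = -1 (mod 3),
   and s(y) = |A| = t (mod 2). Hence the sum is a function of t mod 6 which changes sign when t is
   shifted by 3. *)

theory Submission
  imports Defs
begin

lemma binary_digit_sum_0 [simp]: "binary_digit_sum 0 = 0"
  by (simp add: binary_digit_sum.simps)

lemma binary_digit_sum_rec: "binary_digit_sum n = n mod 2 + binary_digit_sum (n div 2)"
  by (cases "n = 0") (simp_all add: binary_digit_sum.simps[of n])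

text \<open>Induction on \<open>m\<close> strips the lowest bit: halving
  \<open>2 ^ Suc m * q + j\<close> gives \<open>2 ^ m * q + j div 2\<close>, and the bit lost is
  that of \<open>j\<close>. The induction hypothesis is applied to \<open>j div 2\<close>, so
  \<open>j\<close> has to be arbitrary.\<close>

lemma binary_digit_sum_mult_power2_add:
  "j < 2 ^ m \<Longrightarrow> binary_digit_sum (2 ^ m * q + j) = binary_digit_sum q + binary_digit_sum j"
proof (induction m arbitrary: j)
  case (Suc m)
  have "(2 ^ Suc m * q + j) div 2 = 2 ^ m * q + j div 2"
    and "(2 ^ Suc m * q + j) mod 2 = j mod 2"
    by (simp_all add: mult.assoc)
  moreover have "j div 2 < 2 ^ m"
    using Suc.prems by (simp add: less_mult_imp_div_less mult.commute)
  ultimately have "binary_digit_sum (2 ^ Suc m * q + j)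
      = j mod 2 + (binary_digit_sum q + binary_digit_sum (j div 2))"
    by (simp only: binary_digit_sum_rec[of "2 ^ Suc m * q + j"] Suc.IH)
  then show ?case
    by (simp only: binary_digit_sum_rec[of j] add.left_commute)
qed simp

lemma binary_digit_sum_add:
  assumes "2 ^ m dvd y" "j < 2 ^ m"
  shows "binary_digit_sum (y + j) = binary_digit_sum y + binary_digit_sum j"
proof -
  from assms(1) obtain q where "y = 2 ^ m * q" ..
  \<comment> \<open>The instance with offset 0 says that \<open>2 ^ m * q\<close> and
    \<open>q\<close> have the same digit sum, which eliminates \<open>q\<close>.\<close>
  then show ?thesis
    using binary_digit_sum_mult_power2_add[of 0 m q]
      binary_digit_sum_mult_power2_add[OF assms(2), of q] by simp
qed

lemma binary_digit_sum_power2 [simp]: "binary_digit_sum (2 ^ k) = 1"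
  using binary_digit_sum_mult_power2_add[of 0 k 1] binary_digit_sum_rec[of 1] by simp

lemma sum_power2_less:
  fixes A :: "nat set"
  assumes "\<forall>i\<in>A. i < b"
  shows "(\<Sum>i\<in>A. 2 ^ i) < (2 ^ b :: nat)"
proof -
  have "(\<Sum>i\<in>A. 2 ^ i) \<le> (\<Sum>i\<in>{0..<b}. 2 ^ i :: nat)"
    using assms by (intro sum_mono2) auto
  also have "\<dots> < 2 ^ b"
    by (simp add: sum_power2)
  finally show ?thesis .
qed

text \<open>Exponents are inserted in increasing order: the earlier powers sum to less than
  \<open>2 ^ b\<close>, so the new power contributes exactly one further digit.\<close>

lemma binary_digit_sum_sum_power2:
  "finite A \<Longrightarrow> binary_digit_sum (\<Sum>i\<in>A. 2 ^ i) = card A"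
proof (induction A rule: finite_linorder_max_induct)
  case (insert b A)
  then have "b \<notin> A" by blast
  then show ?case
    using insert binary_digit_sum_add[of b "2 ^ b", OF dvd_refl sum_power2_less[of A b]] by simp
qed simp

lemma even_sum_minus_one_power_iff:
  "finite A \<Longrightarrow> even (\<Sum>i\<in>A. (- 1 :: int) ^ i) \<longleftrightarrow> even (card A)"
  by (induction A rule: finite_induct) auto

lemma cong_sum_power2_mod_3:
  "[int (\<Sum>i\<in>A. 2 ^ i) = (\<Sum>i\<in>A. (- 1) ^ i)] (mod 3)"
proof -
  have "[2 = - 1 :: int] (mod 3)"
    by (simp add: cong_def)
  then have "[(\<Sum>i\<in>A. 2 ^ i) = (\<Sum>i\<in>A. (- 1) ^ i :: int)] (mod 3)"
    by (intro cong_sum cong_pow)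
  then show ?thesis by simp
qed

text \<open>The argument \<open>t\<close> stands in for the left end \<open>y\<close> of the
  interval: its parity supplies the sign of \<open>y\<close>, its residue mod 3 that of
  \<open>y\<close>. It is an integer because alternating sums can be negative.\<close>

definition block_sum :: "nat \<Rightarrow> int \<Rightarrow> int" where
  "block_sum m t = (if even t then 1 else - 1) *
     (\<Sum>j | j < 2 ^ m \<and> [t + int j = 0] (mod 3). (- 1) ^ binary_digit_sum j)"

lemma block_sum_0: "block_sum m 0 = S30 (2 ^ m)"
proof -
  have "[0 + int j = 0] (mod 3) \<longleftrightarrow> [j = 0] (mod 3)" for j
    using cong_int_iff[of j 0 3] by simp
  then show ?thesis
    unfolding block_sum_def S30_def by simp
qed

lemma block_sum_residues_cong:
  assumes "[t = t'] (mod 3)"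
  shows "{j. j < 2 ^ m \<and> [t + int j = 0] (mod 3)} = {j. j < 2 ^ m \<and> [t' + int j = 0] (mod 3)}"
proof -
  have "[t + int j = t' + int j] (mod 3)" for j
    using assms by (simp add: cong_add_rcancel)
  then show ?thesis
    using cong_trans cong_sym by blast
qed

text \<open>The sign sees only \<open>t\<close> mod 2 and the index set only \<open>t\<close> mod
  3.\<close>

lemma block_sum_cong:
  assumes "[t = t'] (mod 6)"
  shows "block_sum m t = block_sum m t'"
proof -
  have "[t = t'] (mod 3)"
    using assms by (rule cong_dvd_modulus) simp
  moreover have "[t = t'] (mod 2)"
    using assms by (rule cong_dvd_modulus) simp
  then have "even t \<longleftrightarrow> even t'"
    by (rule cong_dvd_iff)
  ultimately show ?thesis
    unfolding block_sum_def by (simp add: block_sum_residues_cong)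
qed

text \<open>A shift by 3 preserves the residue mod 3 and flips the parity.\<close>

lemma block_sum_add_3: "block_sum m (t + 3) = - block_sum m t"
proof -
  have "[t + 3 = t] (mod 3)"
    by (simp add: cong_def)
  from block_sum_residues_cong[OF this] show ?thesis
    unfolding block_sum_def by simp
qed

lemma S30_ivl_eq_sum:
  "S30_ivl y (y + z) = (\<Sum>j | j < z \<and> [y + j = 0] (mod 3). (- 1) ^ binary_digit_sum (y + j))"
proof -
  let ?f = "\<lambda>n. (- 1 :: int) ^ binary_digit_sum n"
  \<comment> \<open>The part from \<open>y\<close> on is written as a translate, so that the sum
    over it can be reindexed by the offset \<open>j\<close>.\<close>
  have split: "{n. n < y + z \<and> [n = 0] (mod 3)} = {n. n < y \<and> [n = 0] (mod 3)} \<union>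
      (+) y ` {j. j < z \<and> [y + j = 0] (mod 3)}" (is "_ = ?A \<union> ?B")
  proof (intro equalityI subsetI)
    fix n assume n: "n \<in> {n. n < y + z \<and> [n = 0] (mod 3)}"
    show "n \<in> ?A \<union> ?B"
    proof (cases "n < y")
      case False
      then have "n = y + (n - y)" by simp
      moreover from False n have "n - y \<in> {j. j < z \<and> [y + j = 0] (mod 3)}" by auto
      ultimately show ?thesis by blast
    qed (use n in simp)
  qed auto
  have "S30 (y + z) = S30 y + sum ?f ?B"
    unfolding S30_def split by (rule sum.union_disjoint) auto
  then show ?thesis
    unfolding S30_ivl_def by (simp add: sum.reindex)
qed

text \<open>Stated for an arbitrary finite set of exponents, so that it covers both \<open>y\<close>
  and the comparison points such as \<open>2 ^ (2 * n)\<close>. All exponents being at least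
  \<open>m\<close> makes the sum a multiple of \<open>2 ^ m\<close>, which excludes carries.\<close>

lemma S30_ivl_sum_power2:
  assumes "finite A" "\<forall>i\<in>A. m \<le> i"
  shows "S30_ivl (\<Sum>i\<in>A. 2 ^ i) ((\<Sum>i\<in>A. 2 ^ i) + 2 ^ m) = block_sum m (\<Sum>i\<in>A. (- 1) ^ i)"
proof -
  define y :: nat where "y = (\<Sum>i\<in>A. 2 ^ i)"
  define t :: int where "t = (\<Sum>i\<in>A. (- 1) ^ i)"
  have "2 ^ m dvd y"
    unfolding y_def using assms(2) by (intro dvd_sum) (simp add: le_imp_power_dvd)
  then have digits: "(- 1 :: int) ^ binary_digit_sum (y + j)
      = (- 1) ^ binary_digit_sum y * (- 1) ^ binary_digit_sum j" if "j < 2 ^ m" for j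
    using that by (simp add: binary_digit_sum_add power_add)
  have residues: "{j. j < 2 ^ m \<and> [y + j = 0] (mod 3)} =
      {j. j < 2 ^ m \<and> [t + int j = 0] (mod 3)}"
  proof -
    have "[y + j = 0] (mod 3) \<longleftrightarrow> [int y + int j = 0] (mod 3)" for j
      using cong_int_iff[of "y + j" 0 3] by simp
    moreover have "[int y = t] (mod 3)"
      unfolding y_def t_def by (rule cong_sum_power2_mod_3)
    ultimately show ?thesis
      using block_sum_residues_cong by auto
  qed
  have sign: "(- 1 :: int) ^ binary_digit_sum y = (if even t then 1 else - 1)"
    unfolding y_def t_def using assms(1)
    by (simp only: binary_digit_sum_sum_power2 even_sum_minus_one_power_iff minus_one_power_iff)
  have "S30_ivl y (y + 2 ^ m) = (\<Sum>j | j < 2 ^ m \<and> [t + int j = 0] (mod 3).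
      (- 1) ^ binary_digit_sum y * (- 1) ^ binary_digit_sum j)"
    unfolding S30_ivl_eq_sum residues by (rule sum.cong) (simp_all add: digits)
  then have "S30_ivl y (y + 2 ^ m) = block_sum m t"
    unfolding block_sum_def sign by (simp only: sum_distrib_left)
  then show ?thesis
    by (simp only: y_def t_def)
qed

lemma S30_ivl_even_power2:
  assumes "m \<le> 2 * n"
  shows "S30_ivl (2 ^ (2 * n)) (2 ^ (2 * n) + 2 ^ m) = block_sum m 1"
  using S30_ivl_sum_power2[of "{2 * n}" m] assms by simp

text \<open>Positivity of \<open>n\<close> matters: truncated subtraction would turn
  \<open>2 * 0 - 1\<close> into the even exponent 0.\<close>

lemma S30_ivl_odd_power2:
  assumes "0 < n" "m \<le> 2 * n - 1"
  shows "S30_ivl (2 ^ (2 * n - 1)) (2 ^ (2 * n - 1) + 2 ^ m) = block_sum m (- 1)"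
  using S30_ivl_sum_power2[of "{2 * n - 1}" m] assms by simp

lemma S30_ivl_two_even_powers2:
  assumes "0 < k" "m \<le> 2 * k - 2"
  shows "S30_ivl (2 ^ (2 * k) + 2 ^ (2 * k - 2)) (2 ^ (2 * k) + 2 ^ (2 * k - 2) + 2 ^ m)
    = block_sum m 2"
  using S30_ivl_sum_power2[of "{2 * k, 2 * k - 2}" m] assms by simp

lemma S30_ivl_four_even_powers2:
  assumes "3 \<le> k" "m \<le> 2 * k - 6"
    and "u = 2 ^ (2 * k) + 2 ^ (2 * k - 2) + 2 ^ (2 * k - 4) + 2 ^ (2 * k - 6)"
  shows "S30_ivl u (u + 2 ^ m) = block_sum m 4"
proof -
  let ?A = "{2 * k, 2 * k - 2, 2 * k - 4, 2 * k - 6}"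
  \<comment> \<open>From \<open>3 \<le> k\<close> no subtraction truncates; for \<open>k = 2\<close>
    the last two exponents would coincide.\<close>
  have distinct: "2 * k \<notin> {2 * k - 2, 2 * k - 4, 2 * k - 6}"
    "2 * k - 2 \<notin> {2 * k - 4, 2 * k - 6}" "2 * k - 4 \<notin> {2 * k - 6}"
    using assms(1) by auto
  \<comment> \<open>Kept polymorphic in \<open>f\<close>, since it serves both the natural powers of
    2 and the integer powers of -1.\<close>
  have sum: "(\<Sum>i\<in>?A. f i) = f (2 * k) + f (2 * k - 2) + f (2 * k - 4) + f (2 * k - 6)"
    for f :: "nat \<Rightarrow> 'a :: comm_monoid_add"
    by (simp only: sum.insert finite.intros distinct empty_iff not_False_eq_True
        sum.empty add_0_right add.assoc)
  have "\<forall>i\<in>?A. m \<le> i"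
    using assms(2) by auto
  then have "S30_ivl (\<Sum>i\<in>?A. 2 ^ i) ((\<Sum>i\<in>?A. 2 ^ i) + 2 ^ m) = block_sum m (\<Sum>i\<in>?A. (- 1) ^ i)"
    by (intro S30_ivl_sum_power2) simp
  moreover have "(\<Sum>i\<in>?A. (- 1) ^ i) = (4 :: int)"
    unfolding sum by simp
  ultimately show ?thesis
    unfolding assms(3) by (simp only: sum)
qed

theorem mainTheorem4:
  fixes y r m :: nat and e :: "nat \<Rightarrow> nat" and t :: int
  assumes "r \<ge> 1"
    and "\<forall>i\<in>{1..r}. \<forall>j\<in>{1..r}. i < j \<longrightarrow> e i > e j"
    and "y = (\<Sum>i=1..r. 2 ^ e i)"
    and "t = (\<Sum>i=1..r. (-1) ^ e i)"
    and "1 \<le> m" and "m < e r"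
  shows
    "([t = 0] (mod 6) \<longrightarrow> S30_ivl y (y + 2^m) = S30 (2^m)) \<and>
     ([t = 1] (mod 6) \<longrightarrow>
        (\<forall>n::nat. real n > real m / 2 \<longrightarrow>
           S30_ivl y (y + 2^m) = S30_ivl (2^(2*n)) (2^(2*n) + 2^m))) \<and>
     ([t = 2] (mod 6) \<longrightarrow>
        (\<forall>k n::nat. real k > (real m + 2) / 2 \<and> real n > (real m + 1) / 2 \<longrightarrow>
           S30_ivl y (y + 2^m)
             = S30_ivl (2^(2*k) + 2^(2*k-2)) (2^(2*k) + 2^(2*k-2) + 2^m) \<and>
           S30_ivl (2^(2*k) + 2^(2*k-2)) (2^(2*k) + 2^(2*k-2) + 2^m)
             = - S30_ivl (2^(2*n-1)) (2^(2*n-1) + 2^m))) \<and>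
     ([t = 3] (mod 6) \<longrightarrow> S30_ivl y (y + 2^m) = - S30 (2^m)) \<and>
     ([t = 4] (mod 6) \<longrightarrow>
        (\<forall>k n u::nat. real k > (real m + 6) / 2 \<and> real n > real m / 2 \<and>
             u = 2^(2*k) + 2^(2*k-2) + 2^(2*k-4) + 2^(2*k-6) \<longrightarrow>
           S30_ivl y (y + 2^m) = S30_ivl u (u + 2^m) \<and>
           S30_ivl u (u + 2^m) = - S30_ivl (2^(2*n)) (2^(2*n) + 2^m))) \<and>
     ([t = 5] (mod 6) \<longrightarrow>
        (\<forall>k n::nat. real k > (real m + 2) / 2 \<and> real n > (real m + 1) / 2 \<longrightarrow>
           S30_ivl y (y + 2^m)
             = - S30_ivl (2^(2*k) + 2^(2*k-2)) (2^(2*k) + 2^(2*k-2) + 2^m) \<and>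
           - S30_ivl (2^(2*k) + 2^(2*k-2)) (2^(2*k) + 2^(2*k-2) + 2^m)
             = S30_ivl (2^(2*n-1)) (2^(2*n-1) + 2^m)))"
proof -
  have lt: "e j < e i" if "i \<in> {1..r}" "j \<in> {1..r}" "i < j" for i j
    using assms(2) that by blast
  have inj: "inj_on e {1..r}"
  proof (rule inj_onI)
    fix i j assume "i \<in> {1..r}" "j \<in> {1..r}" "e i = e j"
    then show "i = j"
      using lt[of i j] lt[of j i] by (cases i j rule: linorder_cases) simp_all
  qed
  \<comment> \<open>The last exponent is the smallest, so the bound on \<open>e r\<close> passes to
    all of them.\<close>
  have "m \<le> e i" if "i \<in> {1..r}" for i
    using lt[of i r] that assms(1,6) by (cases "i = r") auto
  then have y: "S30_ivl y (y + 2 ^ m) = block_sum m t"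
    using S30_ivl_sum_power2[of "e ` {1..r}" m] assms(3,4)
    by (simp add: sum.reindex[OF inj] del: One_nat_def)
  \<comment> \<open>With \<open>c\<close> equal to 0, 1, 2 or 6 this covers every real bound in the
    statement; it gives \<open>m < 2 * n - c\<close> without truncation.\<close>
  have above: "m + c < 2 * n" if "real n > (real m + real c) / 2" for n c
  proof -
    have "real (m + c) < real (2 * n)"
      using that by simp
    then show ?thesis by (simp only: of_nat_less_iff)
  qed
  have n: "S30_ivl (2^(2*n)) (2^(2*n) + 2^m) = block_sum m 1" if "real n > real m / 2" for n
    using above[of 0 n] that by (intro S30_ivl_even_power2) simp
  have n': "S30_ivl (2^(2*n-1)) (2^(2*n-1) + 2^m) = block_sum m (- 1)"
    if "real n > (real m + 1) / 2" for n
    using above[of 1 n] that by (intro S30_ivl_odd_power2) simp_all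
  have k: "S30_ivl (2^(2*k) + 2^(2*k-2)) (2^(2*k) + 2^(2*k-2) + 2^m) = block_sum m 2"
    if "real k > (real m + 2) / 2" for k
    using above[of 2 k] that by (intro S30_ivl_two_even_powers2) simp_all
  have u: "S30_ivl u (u + 2^m) = block_sum m 4"
    if "real k > (real m + 6) / 2"
      "u = 2^(2*k) + 2^(2*k-2) + 2^(2*k-4) + 2^(2*k-6)" for k u
    using above[of 6 k] that(1) by (intro S30_ivl_four_even_powers2[OF _ _ that(2)]) simp_all
  \<comment> \<open>Shifts by 3 from -1, 0, 1 and 2. The start -1 is the alternating sum of an odd
    power of two.\<close>
  have shifts: "block_sum m 2 = - block_sum m (- 1)" "block_sum m 3 = - S30 (2 ^ m)"
    "block_sum m 4 = - block_sum m 1" "block_sum m 5 = - block_sum m 2"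
    using block_sum_add_3[of m "- 1"] block_sum_add_3[of m 0] block_sum_add_3[of m 1]
      block_sum_add_3[of m 2]
    by (simp_all add: block_sum_0)
  have t: "S30_ivl y (y + 2 ^ m) = block_sum m c" if "[t = c] (mod 6)" for c
    unfolding y using that by (rule block_sum_cong)
  \<comment> \<open>In each case \<open>t\<close> evaluates the left side as
    \<open>block_sum m c\<close>; the comparison values and \<open>shifts\<close> then match both
    sides.\<close>
  show ?thesis
    by (intro conjI impI allI; (elim conjE)?; (drule t)?)
      (simp_all only: n n' k u shifts block_sum_0 minus_minus)
qed

end
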